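(* Let $n\ge 2$. There exists a constant $C(n)>0$, depending only on the dimension $n$, such that for every $0<\delta<1$, every $1<p<\infty$, every weight $w\in A_1$ on $\mathbb{R}^n$, every cube $Q$ in $\mathbb{R}^n$ and every $u\in C^1(Q)$, \[ \ell(Q)^{\delta}\left(\int_Q\int_Q \frac{|u(x)-u(y)|^p}{|x-y|^{n+\delta p}}\,dy\,w(x)\,dx\right)^{\frac1p}\le \frac{C(n)\,p'}{(1-\delta)^{\frac1p}}\,[w]_{A_1}^{\frac2p}\,\ell(Q)\left(\int_Q|\nabla u(x)|^p\,w(x)\,dx\right)^{\frac1p}, \] where $p'=p/(p-1)$.
   Context: A cube $Q$ in $\mathbb{R}^n$ is a cartesian product of $n$ intervals of the same side length, denoted $\ell(Q)$. A weight is a function $w\in L^1_{\mathrm{loc}}(\mathbb{R}^n)$ with $w(x)>0$ for almost every $x$. A weight $w$ belongs to $A_1$ if there is a constant $C>0$ such that $\frac{1}{|Q|}\int_Q w(x)\,dx\le C\,\mathrm{ess\,inf}_{x\in Q}w(x)$ for every cube $Q$ in $\mathbb{R}^n$; the $A_1$ constant $[w]_{A_1}$ is the smallest such $C$. *)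

theory Defs
  imports "HOL-Analysis.Analysis" "HOL-Probability.Essential_Supremum"
begin

text \<open>
  The factors \<open>I i\<close> of a cube may be any bounded intervals (open, closed or half-open) of the
  common length \<open>l > 0\<close>; the two inclusions say exactly that \<open>I i\<close> is an interval with end points
  \<open>a i\<close> and \<open>a i + l\<close>. Note that \<open>l\<close> is determined by \<open>Q\<close>.
\<close>
definition cube :: "(real ^ 'n) set \<Rightarrow> real \<Rightarrow> bool" where
  "cube Q l \<longleftrightarrow> l > 0 \<and>
     (\<exists>(a :: 'n \<Rightarrow> real) (I :: 'n \<Rightarrow> real set).
        (\<forall>i. {a i<..<a i + l} \<subseteq> I i \<and> I i \<subseteq> {a i..a i + l}) \<and>
        Q = {x. \<forall>i. x $ i \<in> I i})"

definition weight :: "(real ^ 'n \<Rightarrow> real) \<Rightarrow> bool" where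
  "weight w \<longleftrightarrow> (\<forall>K. compact K \<longrightarrow> set_integrable lebesgue K w) \<and> (AE x in lebesgue. w x > 0)"

definition essinf_on :: "(real ^ 'n) set \<Rightarrow> (real ^ 'n \<Rightarrow> real) \<Rightarrow> ereal" where
  "essinf_on Q f = - esssup (restrict_space lebesgue Q) (\<lambda>x. - ereal (f x))"

definition A1_bound :: "(real ^ 'n \<Rightarrow> real) \<Rightarrow> real \<Rightarrow> bool" where
  "A1_bound w C \<longleftrightarrow>
     (\<forall>Q l. cube Q l \<longrightarrow>
        ereal (1 / measure lebesgue Q * (\<integral>x\<in>Q. w x \<partial>lebesgue)) \<le> ereal C * essinf_on Q w)"

definition in_A1 :: "(real ^ 'n \<Rightarrow> real) \<Rightarrow> bool" where
  "in_A1 w \<longleftrightarrow> weight w \<and> (\<exists>C>0. A1_bound w C)"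

text \<open>
  For \<open>w\<close> in \<open>A\<^sub>1\<close> the infimum is attained: both the average and the essential infimum of \<open>w\<close> over a
  cube are finite.
\<close>
definition A1_const :: "(real ^ 'n \<Rightarrow> real) \<Rightarrow> real" where
  "A1_const w = Inf {C. C > 0 \<and> A1_bound w C}"

text \<open>
  The derivative is taken within \<open>Q\<close>, so one-sided at those boundary points that belong to \<open>Q\<close>. On a
  cube it is unique, and it is the ordinary derivative in the interior.
\<close>
definition grad_within :: "(real ^ 'n) set \<Rightarrow> (real ^ 'n \<Rightarrow> real) \<Rightarrow> real ^ 'n \<Rightarrow> real ^ 'n" where
  "grad_within Q u x = (\<chi> i. frechet_derivative u (at x within Q) (axis i 1))"

definition C1_on :: "(real ^ 'n) set \<Rightarrow> (real ^ 'n \<Rightarrow> real) \<Rightarrow> bool" where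
  "C1_on Q u \<longleftrightarrow> u differentiable_on Q \<and> continuous_on Q (grad_within Q u)"

text \<open>Real powers of extended nonnegative reals; only meant for exponents \<open>a > 0\<close>.\<close>
definition ennreal_powr :: "ennreal \<Rightarrow> real \<Rightarrow> ennreal" where
  "ennreal_powr x a = (if x = \<infinity> then \<infinity> else ennreal (enn2real x powr a))"

end

theory Submission
  imports Defs
begin

text \<open>
  By the fundamental theorem of calculus and Jensen's inequality,
  \<open>|u x - u y|^p \<le> |x - y|^p \<integral>\<^sub>0\<^sup>1 |\<nabla>u (x + t (y - x))|^p dt\<close>. For fixed \<open>t\<close>, substitute
  \<open>z = x + t (y - x)\<close> and integrate in \<open>x\<close> first. With \<open>a = (1 - \<delta>) p\<close> and \<open>L\<close> a bound for the
  diameter of \<open>Q\<close>, what remains is the truncated potential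
  \<open>t powr - a * \<integral> |x - z| powr (a - n) w x dx\<close> over \<open>|x - z| \<le> t L\<close>. Summing the \<open>A\<^sub>1\<close> condition over
  dyadic balls bounds it by a multiple of \<open>[w] L powr a * w z / (1 - 2 powr - a)\<close>, uniformly in \<open>t\<close>,
  and \<open>1 - 2 powr - a\<close> is at least a multiple of \<open>1 - \<delta>\<close>. This yields the exponent \<open>1/p\<close> of \<open>[w]\<close>
  and no factor \<open>p'\<close>; the stated bound follows because \<open>[w] \<ge> 1\<close> and \<open>p' \<ge> 1\<close>.
\<close>

section \<open>Jensen's inequality for powers on the unit interval\<close>

text \<open>The supporting line of a convex power at \<open>m\<close> comes from Young's inequality
  for \<open>x\<close> and \<open>m powr (p - 1)\<close>: the second factor raised to the conjugate
  exponent \<open>p / (p - 1)\<close> is \<open>m powr p\<close>.\<close>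

lemma powr_ge_tangent:
  fixes x m p :: real
  assumes "p > 1" "x \<ge> 0" "m \<ge> 0"
  shows "m powr p + p * m powr (p - 1) * (x - m) \<le> x powr p"
proof (cases "m = 0")
  case False
  with assms have m: "m > 0" by simp
  define q where "q = p / (p - 1)"
  have q: "q > 1" "1 / p + 1 / q = 1" "(p - 1) * q = p" "p / q = p - 1"
    using assms by (auto simp: q_def field_simps)
  have "x * m powr (p - 1) \<le> x powr p / p + (m powr (p - 1)) powr q / q"
    using Youngs_inequality[of p q x "m powr (p - 1)"] assms q by simp
  also have "(m powr (p - 1)) powr q = m powr p"
    using q by (simp add: powr_powr)
  finally have "p * (x * m powr (p - 1)) \<le> p * (x powr p / p + m powr p / q)"
    using assms by (intro mult_left_mono) auto
  also have "\<dots> = x powr p + (p - 1) * m powr p"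
    unfolding q(4)[symmetric] using assms by (simp add: algebra_simps)
  finally have "p * (x * m powr (p - 1)) \<le> x powr p + (p - 1) * m powr p" .
  moreover have "m * m powr (p - 1) = m powr p"
    using m by (simp add: powr_diff)
  ultimately show ?thesis
    by (simp add: algebra_simps)
qed (use assms in auto)

text \<open>Integrate the tangent bound taken at the mean \<open>m\<close> of \<open>f\<close>; its
  linear term drops out.\<close>

lemma integral_powr_le:
  fixes f :: "real \<Rightarrow> real"
  assumes "p > 1" and cont: "continuous_on {0..1} f" and nonneg: "\<And>t. t \<in> {0..1} \<Longrightarrow> 0 \<le> f t"
  shows "integral {0..1} f powr p \<le> integral {0..1} (\<lambda>t. f t powr p)"
proof -
  define m where "m = integral {0..1} f"
  have intf: "f integrable_on {0..1}"
    using cont integrable_continuous_real by blast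
  have m: "m \<ge> 0"
    unfolding m_def using nonneg by (intro integral_nonneg intf)
  \<comment> \<open>The interval has length 1, so \<open>f t - m\<close> integrates to
    \<open>m - m * 1 = 0\<close>.\<close>
  have "((\<lambda>t. m powr p + p * m powr (p - 1) * (f t - m)) has_integral
          m powr p * (1 - 0) + p * m powr (p - 1) * (m - m * (1 - 0))) {0..1}"
    using has_integral_const_real[of "m powr p" 0 1] has_integral_const_real[of m 0 1] intf
    by (intro has_integral_add has_integral_mult_right has_integral_diff)
       (simp_all add: m_def has_integral_integral[symmetric])
  then have I: "((\<lambda>t. m powr p + p * m powr (p - 1) * (f t - m)) has_integral m powr p) {0..1}"
    by simp
  have "continuous_on {0..1} (\<lambda>t. f t powr p)"
    using cont nonneg assms(1) by (intro continuous_on_powr') auto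
  then have "(\<lambda>t. f t powr p) integrable_on {0..1}"
    using integrable_continuous_real by blast
  then have J: "((\<lambda>t. f t powr p) has_integral integral {0..1} (\<lambda>t. f t powr p)) {0..1}"
    by (simp add: has_integral_integral)
  show ?thesis
    using has_integral_le[OF I J] powr_ge_tangent[of p] assms m by (auto simp: m_def)
qed

section \<open>Gradients and differences along segments\<close>

lemma frechet_derivative_eq_grad_within:
  assumes "u differentiable (at x within Q)"
  shows "frechet_derivative u (at x within Q) h = grad_within Q u x \<bullet> h"
proof -
  have lin: "linear (frechet_derivative u (at x within Q))"
    using assms linear_frechet_derivative by blast
  have "frechet_derivative u (at x within Q) h
      = frechet_derivative u (at x within Q) (\<Sum>i\<in>UNIV. h $ i *\<^sub>R axis i 1)"
    by (simp add: basis_expansion flip: scalar_mult_eq_scaleR)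
  also have "\<dots> = (\<Sum>i\<in>UNIV. h $ i *\<^sub>R frechet_derivative u (at x within Q) (axis i 1))"
    using lin by (simp add: linear_sum linear_scale)
  also have "\<dots> = grad_within Q u x \<bullet> h"
    by (simp add: grad_within_def inner_vec_def mult.commute)
  finally show ?thesis .
qed

lemma continuous_on_grad_segment:
  assumes "C1_on Q u" "convex Q" "x \<in> Q" "y \<in> Q"
  shows "continuous_on {0..1} (\<lambda>t. grad_within Q u (x + t *\<^sub>R (y - x)))"
proof -
  have c: "(\<lambda>t. x + t *\<^sub>R (y - x)) ` {0..1} \<subseteq> Q"
    using convexD_alt[OF assms(2,3,4)] by (auto simp: algebra_simps)
  have "continuous_on Q (grad_within Q u)"
    using assms(1) by (simp add: C1_on_def)
  moreover have "continuous_on {0..1} (\<lambda>t. x + t *\<^sub>R (y - x))"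
    by (intro continuous_intros)
  ultimately show ?thesis
    using c by (rule continuous_on_compose2)
qed

text \<open>The fundamental theorem of calculus is applied along the segment, which stays in
  \<open>Q\<close> by convexity; Cauchy-Schwarz then bounds the directional derivative.\<close>

lemma abs_diff_le_integral_grad:
  assumes C1: "C1_on Q u" and Q: "convex Q" "x \<in> Q" "y \<in> Q"
  shows "\<bar>u x - u y\<bar> \<le> norm (x - y) * integral {0..1} (\<lambda>t. norm (grad_within Q u (x + t *\<^sub>R (y - x))))"
proof -
  let ?c = "\<lambda>t. x + t *\<^sub>R (y - x)"
  have c: "?c ` {0..1} \<subseteq> Q"
    using convexD_alt[OF Q] by (auto simp: algebra_simps)
  note cont = continuous_on_grad_segment[OF C1 Q]
  have "((\<lambda>t. grad_within Q u (?c t) \<bullet> (y - x)) has_integral u (?c 1) - u (?c 0)) {0..1}"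
  proof (rule fundamental_theorem_of_calculus)
    fix t :: real assume t: "t \<in> {0..1}"
    have diff: "u differentiable (at (?c t) within Q)"
      using C1 c t unfolding C1_on_def differentiable_on_def by blast
    \<comment> \<open>A derivative within \<open>Q\<close> restricts to one within the segment, so
      the chain rule also covers boundary points of \<open>Q\<close>, where the derivative is
      one-sided.\<close>
    have "(u has_derivative frechet_derivative u (at (?c t) within Q)) (at (?c t) within ?c ` {0..1})"
      using diff c frechet_derivative_works has_derivative_subset by blast
    moreover have "(?c has_derivative (\<lambda>h. h *\<^sub>R (y - x))) (at t within {0..1})"
      by (auto intro!: derivative_eq_intros)
    ultimately have "(u \<circ> ?c has_derivative
        frechet_derivative u (at (?c t) within Q) \<circ> (\<lambda>h. h *\<^sub>R (y - x))) (at t within {0..1})"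
      by (rule diff_chain_within[rotated])
    then show "((\<lambda>t. u (?c t)) has_vector_derivative grad_within Q u (?c t) \<bullet> (y - x)) (at t within {0..1})"
      by (simp add: has_vector_derivative_def o_def frechet_derivative_eq_grad_within[OF diff])
  qed simp
  then have I: "((\<lambda>t. grad_within Q u (?c t) \<bullet> (y - x)) has_integral u y - u x) {0..1}"
    by simp
  have int: "(\<lambda>t. norm (grad_within Q u (?c t)) * norm (y - x)) integrable_on {0..1}"
    by (intro integrable_continuous_real continuous_intros cont)
  have "norm (u y - u x) \<le> integral {0..1} (\<lambda>t. norm (grad_within Q u (?c t)) * norm (y - x))"
    unfolding integral_unique[OF I, symmetric]
    by (intro integral_norm_bound_integral int has_integral_integrable[OF I])
       (auto simp: Cauchy_Schwarz_ineq2)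
  then show ?thesis
    by (simp add: norm_minus_commute mult.commute abs_minus_commute)
qed

lemma abs_diff_powr_le_nn_integral:
  assumes C1: "C1_on Q u" and Q: "convex Q" "x \<in> Q" "y \<in> Q" and p: "p > 1"
  shows "ennreal (\<bar>u x - u y\<bar> powr p)
    \<le> ennreal (norm (x - y) powr p) *
       (\<integral>\<^sup>+t\<in>{0<..1}. ennreal (norm (grad_within Q u (x + t *\<^sub>R (y - x))) powr p) \<partial>lborel)"
proof -
  let ?f = "\<lambda>t. norm (grad_within Q u (x + t *\<^sub>R (y - x)))"
  have cont: "continuous_on {0..1} ?f"
    by (intro continuous_intros continuous_on_grad_segment assms)
  then have contp: "continuous_on {0..1} (\<lambda>t. ?f t powr p)"
    using p by (intro continuous_on_powr') auto
  have "\<bar>u x - u y\<bar> powr p \<le> (norm (x - y) * integral {0..1} ?f) powr p"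
    using p by (intro powr_mono2 abs_diff_le_integral_grad assms) auto
  also have "\<dots> = norm (x - y) powr p * integral {0..1} ?f powr p"
    by (rule powr_mult)
  also have "\<dots> \<le> norm (x - y) powr p * integral {0..1} (\<lambda>t. ?f t powr p)"
    using integral_powr_le[OF p cont] by (intro mult_left_mono) auto
  finally have *: "\<bar>u x - u y\<bar> powr p \<le> norm (x - y) powr p * integral {0..1} (\<lambda>t. ?f t powr p)" .
  have "ennreal (integral {0..1} (\<lambda>t. ?f t powr p)) = (\<integral>\<^sup>+t\<in>{0..1}. ennreal (?f t powr p) \<partial>lborel)"
    using contp by (intro nn_integral_has_integral_lebesgue'[symmetric])
      (auto simp: has_integral_integral[symmetric] integrable_continuous_real)
  \<comment> \<open>Dropping the null set \<open>t = 0\<close> keeps the later substitution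
    \<open>z = x + t (y - x)\<close> invertible for every remaining \<open>t\<close>.\<close>
  also have "\<dots> = (\<integral>\<^sup>+t\<in>{0<..1}. ennreal (?f t powr p) \<partial>lborel)"
    by (intro nn_integral_cong_AE, use AE_lborel_singleton[of "0::real"] in eventually_elim)
       (auto simp: indicator_def)
  finally have **: "ennreal (integral {0..1} (\<lambda>t. ?f t powr p)) = \<dots>" .
  have "ennreal (\<bar>u x - u y\<bar> powr p) \<le> ennreal (norm (x - y) powr p * integral {0..1} (\<lambda>t. ?f t powr p))"
    using * by (rule ennreal_leI)
  also have "\<dots> = ennreal (norm (x - y) powr p) * ennreal (integral {0..1} (\<lambda>t. ?f t powr p))"
    by (rule ennreal_mult') simp
  finally show ?thesis
    unfolding ** .
qed

section \<open>Geometry and measurability of cubes\<close>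

lemma cube_cbox:
  assumes "l > 0"
  shows "cube (cbox a (a + (\<chi> i. l))) l"
  using assms unfolding cube_def
  by (intro conjI exI[of _ "\<lambda>i. a $ i"] exI[of _ "\<lambda>i. {a $ i..a $ i + l}"])
     (auto simp: mem_box_cart)

lemma cube_pos: "cube Q l \<Longrightarrow> l > 0"
  by (auto simp: cube_def)

lemma convex_cube:
  assumes "cube Q l"
  shows "convex Q"
proof -
  obtain a I where "\<forall>i. {a i<..<a i + l} \<subseteq> I i \<and> I i \<subseteq> {a i..a i + l}"
    and Q: "Q = {x. \<forall>i. x $ i \<in> I i}"
    using assms unfolding cube_def by auto
  then have I: "\<And>i. {a i<..<a i + l} \<subseteq> I i" "\<And>i. I i \<subseteq> {a i..a i + l}"
    by auto
  have "is_interval (I i)" for i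
    unfolding is_interval_1
  proof (intro ballI allI impI)
    fix r s x assume rs: "r \<in> I i" "s \<in> I i" "r \<le> x \<and> x \<le> s"
    \<comment> \<open>A point other than \<open>r\<close> and \<open>s\<close> lies strictly between
      two points of the closed interval, hence in the open interval contained in
      \<open>I i\<close>.\<close>
    then consider "x = r" | "x = s" | "a i < x" "x < a i + l"
      using I(2)[of i] by fastforce
    then show "x \<in> I i"
      using rs I(1)[of i] by cases auto
  qed
  then have "convex (I i)" for i
    by (simp add: is_interval_convex_1)
  then show ?thesis
    unfolding Q convex_def by auto
qed

lemma borel_cube:
  assumes "cube Q l"
  shows "Q \<in> sets borel"
proof -
  obtain a I where "\<forall>i. {a i<..<a i + l} \<subseteq> I i \<and> I i \<subseteq> {a i..a i + l}"
    and Q: "Q = {x. \<forall>i. x $ i \<in> I i}"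
    using assms unfolding cube_def by auto
  then have I: "\<And>i. {a i<..<a i + l} \<subseteq> I i" "\<And>i. I i \<subseteq> {a i..a i + l}"
    by auto
  \<comment> \<open>The factor is an open interval plus at most two end points, and finite sets are
    closed.\<close>
  have "I i = {a i<..<a i + l} \<union> (I i \<inter> {a i, a i + l})" for i
    using I[of i] by fastforce
  moreover have "I i \<inter> {a i, a i + l} \<in> sets borel" for i
    by (intro borel_closed finite_imp_closed) auto
  ultimately have [measurable]: "I i \<in> sets borel" for i
    by (metis borel_open open_greaterThanLessThan sets.Un)
  have "Q = {x \<in> space borel. \<forall>i. x $ i \<in> I i}"
    by (simp add: Q)
  also have "\<dots> \<in> sets borel"
    by measurable
  finally show ?thesis .
qed

lemma cube_subset_cbox:
  assumes "cube Q l"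
  obtains a where "Q \<subseteq> cbox a (a + (\<chi> i. l))"
proof -
  obtain a I where I: "\<forall>i. {a i<..<a i + l} \<subseteq> I i \<and> I i \<subseteq> {a i..a i + l}"
    and Q: "Q = {x. \<forall>i. x $ i \<in> I i}"
    using assms unfolding cube_def by auto
  have "Q \<subseteq> cbox (\<chi> i. a i) ((\<chi> i. a i) + (\<chi> i. l))"
    using I by (auto simp: Q mem_box_cart subset_iff)
  then show ?thesis
    by (rule that)
qed

text \<open>The Euclidean norm is at most the sum of the coordinate differences, each at most
  \<open>l\<close>. The crude factor \<open>CARD('n)\<close> only enters the dimensional
  constant.\<close>

lemma cube_norm_le:
  fixes Q :: "(real ^ 'n::finite) set"
  assumes "cube Q l" "x \<in> Q" "y \<in> Q"
  shows "norm (x - y) \<le> real CARD('n) * l"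
proof -
  obtain a where a: "Q \<subseteq> cbox a (a + (\<chi> i. l))"
    using assms(1) by (rule cube_subset_cbox)
  have "\<bar>(x - y) $ i\<bar> \<le> l" for i
  proof -
    have "x \<in> cbox a (a + (\<chi> i. l))" "y \<in> cbox a (a + (\<chi> i. l))"
      using a assms by auto
    then have "a $ i \<le> x $ i" "x $ i \<le> a $ i + l" "a $ i \<le> y $ i" "y $ i \<le> a $ i + l"
      by (auto simp: mem_box_cart)
    then show ?thesis by simp
  qed
  then have "(\<Sum>i\<in>UNIV. \<bar>(x - y) $ i\<bar>) \<le> real CARD('n) * l"
    by (intro sum_bounded_above) auto
  then show ?thesis
    using norm_le_l1_cart[of "x - y"] by linarith
qed

lemma measure_cbox_cube:
  fixes a :: "real ^ 'n::finite"
  assumes "l > 0"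
  shows "measure lebesgue (cbox a (a + (\<chi> i. l))) = l ^ CARD('n)"
proof -
  have "a \<in> cbox a (a + (\<chi> i. l))"
    using assms by (simp add: mem_box_cart)
  then have "cbox a (a + (\<chi> i. l)) \<noteq> {}"
    by blast
  then show ?thesis
    by (simp add: content_cbox_cart)
qed

section \<open>Pointwise consequences of the \<open>A_1\<close> condition\<close>

text \<open>Local integrability makes the truncations of \<open>w\<close> to closed balls
  measurable, and these converge pointwise to \<open>w\<close>.\<close>

lemma weight_measurable:
  fixes w :: "real ^ 'n::finite \<Rightarrow> real"
  assumes "weight w"
  shows "w \<in> borel_measurable lebesgue"
proof (rule borel_measurable_LIMSEQ_real)
  show "(\<lambda>x. indicator (cball 0 (real k)) x *\<^sub>R w x) \<in> borel_measurable lebesgue" for k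
    using assms compact_cball unfolding weight_def set_integrable_def by blast
  fix x :: "real ^ 'n"
  obtain k where "norm x \<le> real k"
    using real_arch_simple by blast
  then have "\<forall>\<^sub>F j in sequentially. indicator (cball 0 (real j)) x *\<^sub>R w x = w x"
    by (intro eventually_sequentiallyI[of k]) (auto simp: indicator_def)
  then show "(\<lambda>k. indicator (cball 0 (real k)) x *\<^sub>R w x) \<longlonglongrightarrow> w x"
    by (rule tendsto_eventually)
qed

lemma weight_set_integrable_cube:
  assumes "weight w" "cube Q l"
  shows "set_integrable lebesgue Q w"
proof -
  obtain a where a: "Q \<subseteq> cbox a (a + (\<chi> i. l))"
    using assms(2) by (rule cube_subset_cbox)
  have "set_integrable lebesgue (cbox a (a + (\<chi> i. l))) w"
    using assms(1) compact_cbox unfolding weight_def by blast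
  then show ?thesis
    using a borel_cube[OF assms(2)] by (intro set_integrable_subset[of lebesgue "cbox a (a + (\<chi> i. l))" w Q]) auto
qed

text \<open>Every admissible constant is at least the average divided by \<open>w z\<close>, hence
  so is their infimum \<open>A1_const w\<close>. The exceptional null set depends on
  \<open>Q\<close> but not on the constant.\<close>

lemma A1_average_le:
  fixes w :: "real ^ 'n::finite \<Rightarrow> real"
  assumes w: "in_A1 w" and Q: "cube Q l"
  shows "AE z in lebesgue. z \<in> Q \<longrightarrow> 1 / measure lebesgue Q * (\<integral>x\<in>Q. w x \<partial>lebesgue) \<le> A1_const w * w z"
proof -
  let ?avg = "1 / measure lebesgue Q * (\<integral>x\<in>Q. w x \<partial>lebesgue)"
  have pos: "AE z in lebesgue. w z > 0"
    using w by (auto simp: in_A1_def weight_def)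
  have "AE z in restrict_space lebesgue Q. - ereal (w z) \<le> - essinf_on Q w"
    unfolding essinf_on_def using esssup_AE[of "\<lambda>z. - ereal (w z)"] by simp
  then have ess: "AE z in lebesgue. z \<in> Q \<longrightarrow> essinf_on Q w \<le> ereal (w z)"
    using borel_cube[OF Q] by (subst (asm) AE_restrict_space_iff) (auto simp: ereal_uminus_le_reorder simp flip: uminus_ereal.simps)
  show ?thesis
    using pos ess
  proof eventually_elim
    case (elim z)
    show ?case
    proof
      assume z: "z \<in> Q"
      have "?avg / w z \<le> C" if "C > 0" "A1_bound w C" for C
      proof -
        have "ereal ?avg \<le> ereal C * essinf_on Q w"
          using that Q by (auto simp: A1_bound_def)
        also have "\<dots> \<le> ereal C * ereal (w z)"
          using elim z that by (intro ereal_mult_left_mono) auto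
        finally have "?avg \<le> C * w z" by simp
        then show ?thesis
          using elim by (subst pos_divide_le_eq) auto
      qed
      moreover have "{C. C > 0 \<and> A1_bound w C} \<noteq> {}"
        using w by (auto simp: in_A1_def)
      ultimately have "?avg / w z \<le> A1_const w"
        unfolding A1_const_def by (intro cInf_greatest) auto
      then show "?avg \<le> A1_const w * w z"
        using elim by (subst (asm) pos_divide_le_eq) auto
    qed
  qed
qed

text \<open>Integrating the bound of \<open>A1_average_le\<close> over the unit cube compares the
  mean of \<open>w\<close> with \<open>A1_const w\<close> times itself, and a positive mean can be
  cancelled.\<close>

lemma A1_const_ge_1:
  fixes w :: "real ^ 'n::finite \<Rightarrow> real"
  assumes w: "in_A1 w"
  shows "A1_const w \<ge> 1"
proof -
  define Q :: "(real ^ 'n) set" where "Q = cbox 0 (0 + (\<chi> i. 1))"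
  have Q: "cube Q 1" and m: "measure lebesgue Q = 1"
    unfolding Q_def using cube_cbox[of 1 0] measure_cbox_cube[of 1 0] by auto
  have Qs: "Q \<in> sets lebesgue" "emeasure lebesgue Q = 1"
    by (simp add: Q_def) (metis Q_def m emeasure_eq_ennreal_measure ennreal_1 fmeasurableD2 lmeasurable_cbox)
  have pos: "AE z in lebesgue. w z > 0" and wt: "weight w"
    using w by (auto simp: in_A1_def weight_def)
  let ?I = "\<integral>x\<in>Q. w x \<partial>lebesgue"
  have int: "set_integrable lebesgue Q w"
    by (rule weight_set_integrable_cube[OF wt Q])
  have "?I \<ge> 0"
    unfolding set_lebesgue_integral_def using pos by (intro integral_nonneg_AE) (auto elim!: eventually_mono)
  \<comment> \<open>A vanishing mean would force \<open>w = 0\<close> almost everywhere on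
    \<open>Q\<close>, which has measure 1, against the positivity of \<open>w\<close>.\<close>
  moreover have "?I \<noteq> 0"
  proof
    assume "?I = 0"
    then have "AE x in lebesgue. indicator Q x *\<^sub>R w x = 0"
      using int pos unfolding set_lebesgue_integral_def set_integrable_def
      by (subst (asm) integral_nonneg_eq_0_iff_AE) (auto elim!: eventually_mono)
    with pos have "AE x in lebesgue. x \<notin> Q"
      by eventually_elim auto
    then show False
      using Qs by (simp add: AE_iff_measurable[OF Qs(1)])
  qed
  ultimately have I: "?I > 0" by simp
  have "?I = (\<integral>x\<in>Q. ?I \<partial>lebesgue)"
    using m Qs by (simp add: set_lebesgue_integral_def)
  also have "\<dots> \<le> (\<integral>x\<in>Q. A1_const w * w x \<partial>lebesgue)"
  proof (rule set_integral_mono_AE)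
    show "set_integrable lebesgue Q (\<lambda>x. ?I)"
      using Qs by (simp add: set_integrable_def)
    show "set_integrable lebesgue Q (\<lambda>x. A1_const w * w x)"
      using int by simp
    show "AE x\<in>Q in lebesgue. ?I \<le> A1_const w * w x"
      using A1_average_le[OF w Q] m by simp
  qed
  also have "\<dots> = A1_const w * ?I"
    by simp
  finally show ?thesis
    using I by simp
qed

lemma rational_cube_around_cball:
  fixes z :: "real ^ 'n::finite"
  assumes "R > 0"
  obtains a :: "'n \<Rightarrow> rat" and l :: rat where "l > 0" "of_rat l \<le> 4 * R"
    "cball z R \<subseteq> cbox (\<chi> i. of_rat (a i)) ((\<chi> i. of_rat (a i)) + (\<chi> i. of_rat l))"
proof -
  \<comment> \<open>With a corner coordinate between \<open>z $ i - 2 * R\<close> and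
    \<open>z $ i - R\<close>, a side above \<open>3 * R\<close> reaches past
    \<open>z $ i + R\<close>.\<close>
  obtain l :: rat where l: "3 * R < of_rat l" "of_rat l < 4 * R"
    using of_rat_dense[of "3 * R" "4 * R"] assms by auto
  have "\<exists>q::rat. z $ i - 2 * R < of_rat q \<and> of_rat q < z $ i - R" for i
    using of_rat_dense[of "z $ i - 2 * R" "z $ i - R"] assms by auto
  then obtain a :: "'n \<Rightarrow> rat" where a: "\<And>i. z $ i - 2 * R < of_rat (a i)" "\<And>i. of_rat (a i) < z $ i - R"
    by metis
  show ?thesis
  proof (rule that[of l a])
    have "(0::real) < of_rat l" using l assms by linarith
    then show "l > 0" by simp
    show "of_rat l \<le> 4 * R" using l by simp
    show "cball z R \<subseteq> cbox (\<chi> i. of_rat (a i)) ((\<chi> i. of_rat (a i)) + (\<chi> i. of_rat l))"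
    proof
      fix x assume x: "x \<in> cball z R"
      have "of_rat (a i) \<le> x $ i \<and> x $ i \<le> of_rat (a i) + of_rat l" for i
      proof -
        have "\<bar>(z - x) $ i\<bar> \<le> R"
          using x component_le_norm_cart[of "z - x" i] by (simp add: dist_norm)
        then have "z $ i - R \<le> x $ i" "x $ i \<le> z $ i + R"
          by (auto simp: abs_le_iff)
        then show ?thesis
          using a[of i] l by linarith
      qed
      then show "x \<in> cbox (\<chi> i. of_rat (a i)) ((\<chi> i. of_rat (a i)) + (\<chi> i. of_rat l))"
        by (simp add: mem_box_cart)
    qed
  qed
qed

text \<open>Every ball lies in a cube with rational data of comparable size, so that the exceptional null
  sets of the \<open>A\<^sub>1\<close> condition can be chosen uniformly in the cube.\<close>
lemma A1_ball_le:
  fixes w :: "real ^ 'n::finite \<Rightarrow> real"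
  assumes w: "in_A1 w"
  shows "AE z in lebesgue. \<forall>R>0. (\<integral>\<^sup>+x\<in>cball z R. ennreal (w x) \<partial>lebesgue)
           \<le> ennreal ((4 * R) ^ CARD('n) * A1_const w * w z)"
proof -
  define Q :: "('n \<Rightarrow> rat) \<Rightarrow> rat \<Rightarrow> (real ^ 'n) set"
    where "Q a l = cbox (\<chi> i. of_rat (a i)) ((\<chi> i. of_rat (a i)) + (\<chi> i. of_rat l))" for a l
  have pos: "AE z in lebesgue. w z > 0" and wt: "weight w"
    using w by (auto simp: in_A1_def weight_def)
  have Q: "cube (Q a l) (of_rat l)" "measure lebesgue (Q a l) = of_rat l ^ CARD('n)" if "l > 0" for a l
    unfolding Q_def using cube_cbox[of "of_rat l"] measure_cbox_cube[of "of_rat l"] that by auto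
  have "AE z in lebesgue. \<forall>a l. l > 0 \<longrightarrow> z \<in> Q a l \<longrightarrow>
      1 / measure lebesgue (Q a l) * (\<integral>x\<in>Q a l. w x \<partial>lebesgue) \<le> A1_const w * w z"
  proof (unfold AE_all_countable, intro allI)
    fix a l show "AE z in lebesgue. l > 0 \<longrightarrow> z \<in> Q a l \<longrightarrow>
      1 / measure lebesgue (Q a l) * (\<integral>x\<in>Q a l. w x \<partial>lebesgue) \<le> A1_const w * w z"
      using A1_average_le[OF w Q(1)] by (cases "l > 0") auto
  qed
  with pos show ?thesis
  proof eventually_elim
    case (elim z)
    show ?case
    proof (intro allI impI)
      fix R :: real assume R: "R > 0"
      obtain a l where l: "l > 0" "of_rat l \<le> 4 * R" and sub: "cball z R \<subseteq> Q a l"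
        using rational_cube_around_cball[OF R, of z] unfolding Q_def by metis
      have z: "z \<in> Q a l"
        using sub R by auto
      have A: "A1_const w \<ge> 1"
        by (rule A1_const_ge_1[OF w])
      have int: "set_integrable lebesgue (Q a l) w"
        by (rule weight_set_integrable_cube[OF wt Q(1)[OF l(1)]])
      have "(\<integral>\<^sup>+x\<in>cball z R. ennreal (w x) \<partial>lebesgue) \<le> (\<integral>\<^sup>+x. ennreal (indicator (Q a l) x *\<^sub>R w x) \<partial>lebesgue)"
        using sub by (intro nn_integral_mono) (auto simp: indicator_def)
      also have "\<dots> = ennreal (\<integral>x\<in>Q a l. w x \<partial>lebesgue)"
        unfolding set_lebesgue_integral_def using int pos
        by (intro nn_integral_eq_integral) (auto simp: set_integrable_def elim!: eventually_mono)
      \<comment> \<open>Multiply the bound on the average by the volume of the cube; the side is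
        enlarged to \<open>4 * R\<close> afterwards.\<close>
      also have "\<dots> \<le> ennreal (of_rat l ^ CARD('n) * (A1_const w * w z))"
        using elim(2)[rule_format, OF l(1) z] l(1) by (intro ennreal_leI) (simp add: Q(2) field_simps)
      also have "\<dots> \<le> ennreal ((4 * R) ^ CARD('n) * (A1_const w * w z))"
        using l A elim(1) by (intro ennreal_leI mult_right_mono power_mono) auto
      finally show "(\<integral>\<^sup>+x\<in>cball z R. ennreal (w x) \<partial>lebesgue) \<le> ennreal ((4 * R) ^ CARD('n) * A1_const w * w z)"
        by (simp add: mult.assoc)
    qed
  qed
qed

section \<open>Truncated Riesz potentials and substitution along segments\<close>

lemma nn_integral_lborel_affine:
  fixes f :: "'a::euclidean_space \<Rightarrow> ennreal"
  assumes [measurable]: "f \<in> borel_measurable borel" and c: "c \<noteq> 0"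
  shows "(\<integral>\<^sup>+x. f x \<partial>lborel) = ennreal (\<bar>c\<bar> ^ DIM('a)) * (\<integral>\<^sup>+x. f (b + c *\<^sub>R x) \<partial>lborel)"
  by (subst lborel_affine[OF c, of b])
     (simp add: nn_integral_density nn_integral_distr nn_integral_cmult)

text \<open>Take the dyadic shell between radii \<open>R / 2 ^ (k + 1)\<close> and
  \<open>R / 2 ^ k\<close> that contains \<open>r\<close>. Passing to the outer radius costs a
  factor 1 if \<open>a \<ge> n\<close> and at most \<open>2 powr (n - a)\<close> otherwise;
  \<open>2 ^ n\<close> covers both.\<close>

lemma powr_le_dyadic:
  fixes r R a :: real
  assumes "0 < r" "r \<le> R" "0 < a"
  obtains k :: nat where "r \<le> R / 2 ^ k" "r powr (a - real n) \<le> 2 ^ n * (R / 2 ^ k) powr (a - real n)"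
proof -
  define k where "k = nat \<lfloor>log 2 (R / r)\<rfloor>"
  have Rr: "R / r \<ge> 1" using assms by simp
  then have "log 2 (R / r) \<ge> 0" by simp
  then have "real k \<le> log 2 (R / r)" "log 2 (R / r) < real (Suc k)"
    unfolding k_def by linarith+
  then have "2 powr real k \<le> R / r" "R / r < 2 powr real (Suc k)"
    using Rr by (simp_all add: le_log_iff log_less_iff)
  then have k: "2 ^ k \<le> R / r" "R / r < 2 ^ Suc k"
    by (simp_all only: powr_realpow zero_less_numeral)
  define \<rho> where "\<rho> = R / 2 ^ k"
  have \<rho>: "r \<le> \<rho>" "\<rho> / 2 \<le> r" "\<rho> > 0"
    using k assms by (auto simp: \<rho>_def field_simps)
  have "r powr (a - real n) \<le> 2 ^ n * \<rho> powr (a - real n)"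
  proof (cases "a \<ge> real n")
    case True
    have "r powr (a - real n) \<le> 1 * \<rho> powr (a - real n)"
      using True \<rho> assms by (simp add: powr_mono2)
    also have "\<dots> \<le> 2 ^ n * \<rho> powr (a - real n)"
      by (intro mult_right_mono) auto
    finally show ?thesis .
  next
    case False
    have "r powr (a - real n) \<le> (\<rho> / 2) powr (a - real n)"
      using False \<rho> by (intro powr_mono2') auto
    also have "\<dots> = 2 powr (real n - a) * \<rho> powr (a - real n)"
      using \<rho> by (simp add: powr_divide powr_diff field_simps)
    also have "\<dots> \<le> 2 powr real n * \<rho> powr (a - real n)"
      using assms by (intro mult_right_mono powr_mono) auto
    finally show ?thesis
      by (simp add: powr_realpow)
  qed
  then show ?thesis
    using that[of k] \<rho> by (simp add: \<rho>_def)
qed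

text \<open>The kernel is dominated by a sum of multiples of indicators of the balls of radius
  \<open>R / 2 ^ k\<close>. The bound on balls turns this sum into a geometric series of ratio
  \<open>2 powr - a\<close>.\<close>

lemma nn_integral_riesz_kernel_le:
  fixes W :: "'a::euclidean_space \<Rightarrow> ennreal" and M :: ennreal
  assumes [measurable]: "W \<in> borel_measurable borel"
    and ball: "\<And>r. r > 0 \<Longrightarrow> (\<integral>\<^sup>+x\<in>cball z r. W x \<partial>lborel) \<le> ennreal (r ^ DIM('a)) * M"
    and a: "a > 0" and R: "R > 0"
  shows "(\<integral>\<^sup>+x. indicator {..R} (norm (x - z)) * ennreal (norm (x - z) powr (a - real DIM('a))) * W x \<partial>lborel)
    \<le> ennreal (2 ^ DIM('a) * R powr a / (1 - 2 powr - a)) * M"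
proof -
  let ?n = "DIM('a)"
  define \<rho> where "\<rho> k = R / 2 ^ k" for k :: nat
  define q :: real where "q = 2 powr - a"
  have \<rho>: "\<rho> k > 0" for k using R by (simp add: \<rho>_def)
  have [measurable]: "(\<lambda>x. W x * indicator (cball z r) x) \<in> borel_measurable lborel" for r
  proof -
    have [measurable]: "cball z r \<in> sets borel" by simp
    show ?thesis by measurable
  qed
  have q: "0 < q" "q < 1"
    using a powr_less_mono[of "- a" 0 2] by (auto simp: q_def)
  have "indicator {..R} (norm (x - z)) * ennreal (norm (x - z) powr (a - real ?n)) * W x
     \<le> (\<Sum>k. ennreal (2 ^ ?n * \<rho> k powr (a - real ?n)) * (W x * indicator (cball z (\<rho> k)) x))" for x
  \<comment> \<open>In the other case the left side is 0: either the truncation cuts off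
    \<open>x\<close>, or \<open>x = z\<close> and \<open>0 powr _ = 0\<close>.\<close>
  proof (cases "0 < norm (x - z) \<and> norm (x - z) \<le> R")
    case True
    then obtain k where k: "norm (x - z) \<le> \<rho> k"
        "norm (x - z) powr (a - real ?n) \<le> 2 ^ ?n * \<rho> k powr (a - real ?n)"
      using powr_le_dyadic[of "norm (x - z)" R a ?n] a unfolding \<rho>_def by blast
    have "indicator {..R} (norm (x - z)) * ennreal (norm (x - z) powr (a - real ?n)) * W x
        \<le> ennreal (2 ^ ?n * \<rho> k powr (a - real ?n)) * W x"
      using k(2) by (intro mult_right_mono) (auto simp: indicator_def ennreal_leI)
    also have "\<dots> = ennreal (2 ^ ?n * \<rho> k powr (a - real ?n)) * (W x * indicator (cball z (\<rho> k)) x)"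
      using k(1) by (simp add: dist_norm norm_minus_commute)
    also have "\<dots> \<le> (\<Sum>k. ennreal (2 ^ ?n * \<rho> k powr (a - real ?n)) * (W x * indicator (cball z (\<rho> k)) x))"
      using sum_le_suminf[of "\<lambda>k. ennreal (2 ^ ?n * \<rho> k powr (a - real ?n)) * (W x * indicator (cball z (\<rho> k)) x)" "{k}"]
      by simp
    finally show ?thesis .
  qed (auto simp: indicator_def)
  then have "(\<integral>\<^sup>+x. indicator {..R} (norm (x - z)) * ennreal (norm (x - z) powr (a - real ?n)) * W x \<partial>lborel)
    \<le> (\<integral>\<^sup>+x. (\<Sum>k. ennreal (2 ^ ?n * \<rho> k powr (a - real ?n)) * (W x * indicator (cball z (\<rho> k)) x)) \<partial>lborel)"
    by (intro nn_integral_mono)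
  also have "\<dots> = (\<Sum>k. \<integral>\<^sup>+x. ennreal (2 ^ ?n * \<rho> k powr (a - real ?n)) * (W x * indicator (cball z (\<rho> k)) x) \<partial>lborel)"
    by (rule nn_integral_suminf) measurable
  also have "\<dots> = (\<Sum>k. ennreal (2 ^ ?n * \<rho> k powr (a - real ?n)) * (\<integral>\<^sup>+x\<in>cball z (\<rho> k). W x \<partial>lborel))"
    by (subst nn_integral_cmult) auto
  also have "\<dots> \<le> (\<Sum>k. ennreal (2 ^ ?n * R powr a * q ^ k) * M)"
  proof (intro suminf_le)
    fix k
    \<comment> \<open>The volume of the ball cancels the dimension in the exponent of the kernel, so
      only \<open>a\<close> governs the decay in \<open>k\<close>.\<close>
    have "\<rho> k powr (a - real ?n) * \<rho> k ^ ?n = \<rho> k powr a"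
      using \<rho>[of k] by (simp add: powr_diff powr_realpow)
    also have "\<dots> = R powr a * q ^ k"
    proof -
      have "q ^ k = q powr real k"
        using q by (simp add: powr_realpow)
      also have "\<dots> = inverse ((2 powr real k) powr a)"
        by (simp add: q_def powr_powr mult.commute flip: powr_minus)
      also have "2 powr real k = (2::real) ^ k"
        by (simp add: powr_realpow)
      finally have qk: "q ^ k = inverse ((2 ^ k) powr a)" .
      show ?thesis
        unfolding qk \<rho>_def using R by (simp add: powr_divide inverse_eq_divide)
    qed
    finally have eq: "\<rho> k powr (a - real ?n) * \<rho> k ^ ?n = R powr a * q ^ k" .
    have "ennreal (2 ^ ?n * \<rho> k powr (a - real ?n)) * (\<integral>\<^sup>+x\<in>cball z (\<rho> k). W x \<partial>lborel)
        \<le> ennreal (2 ^ ?n * \<rho> k powr (a - real ?n)) * (ennreal (\<rho> k ^ ?n) * M)"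
      by (intro mult_left_mono ball \<rho>) auto
    also have "\<dots> = ennreal (2 ^ ?n * \<rho> k powr (a - real ?n) * \<rho> k ^ ?n) * M"
      by (subst ennreal_mult') (auto simp: mult.assoc)
    also have "2 ^ ?n * \<rho> k powr (a - real ?n) * \<rho> k ^ ?n = 2 ^ ?n * R powr a * q ^ k"
      using eq by (simp add: mult.assoc)
    finally show "ennreal (2 ^ ?n * \<rho> k powr (a - real ?n)) * (\<integral>\<^sup>+x\<in>cball z (\<rho> k). W x \<partial>lborel)
        \<le> ennreal (2 ^ ?n * R powr a * q ^ k) * M" .
  qed auto
  also have "\<dots> = (\<Sum>k. ennreal (2 ^ ?n * R powr a * q ^ k)) * M"
    by simp
  also have "(\<Sum>k. ennreal (2 ^ ?n * R powr a * q ^ k)) = ennreal (2 ^ ?n * R powr a * (1 / (1 - q)))"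
  proof (rule suminf_ennreal_eq)
    show "(\<lambda>k. 2 ^ ?n * R powr a * q ^ k) sums (2 ^ ?n * R powr a * (1 / (1 - q)))"
      using q by (intro sums_mult geometric_sums) auto
  qed (use q in auto)
  finally show ?thesis
    by (simp add: q_def)
qed

text \<open>Under \<open>z = x + t (y - x)\<close> distances scale by \<open>t\<close>, the kernel
  by \<open>t powr (a - n)\<close> and volume by \<open>t ^ n\<close>; what is left over is
  \<open>t powr - a\<close> and the radius \<open>t * L\<close>.\<close>

lemma nn_integral_segment_kernel:
  fixes G :: "'a::euclidean_space \<Rightarrow> ennreal"
  assumes [measurable]: "G \<in> borel_measurable borel" and t: "t > 0"
  shows "(\<integral>\<^sup>+y. indicator {..L} (norm (x - y)) * ennreal (norm (x - y) powr (a - real DIM('a))) * G (x + t *\<^sub>R (y - x)) \<partial>lborel)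
    = ennreal (t powr - a) *
      (\<integral>\<^sup>+z. indicator {..t * L} (norm (x - z)) * ennreal (norm (x - z) powr (a - real DIM('a))) * G z \<partial>lborel)"
    (is "?I = _ * ?J")
proof -
  let ?n = "DIM('a)"
  define H where "H y = indicator {..L} (norm (x - y)) * ennreal (norm (x - y) powr (a - real ?n)) * G (x + t *\<^sub>R (y - x))" for y
  have [measurable]: "H \<in> borel_measurable borel"
    unfolding H_def by measurable
  \<comment> \<open>The change of variables is applied to the right-hand integral, with the base
    point of the affine map chosen as \<open>x - t *\<^sub>R x\<close>.\<close>
  have "?J = ennreal (\<bar>t\<bar> ^ ?n) *
      (\<integral>\<^sup>+y. indicator {..t * L} (norm (x - ((x - t *\<^sub>R x) + t *\<^sub>R y)))
        * ennreal (norm (x - ((x - t *\<^sub>R x) + t *\<^sub>R y)) powr (a - real ?n)) * G ((x - t *\<^sub>R x) + t *\<^sub>R y) \<partial>lborel)"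
    using t by (intro nn_integral_lborel_affine) auto
  also have "(\<lambda>y. indicator {..t * L} (norm (x - ((x - t *\<^sub>R x) + t *\<^sub>R y)))
        * ennreal (norm (x - ((x - t *\<^sub>R x) + t *\<^sub>R y)) powr (a - real ?n)) * G ((x - t *\<^sub>R x) + t *\<^sub>R y))
      = (\<lambda>y. ennreal (t powr (a - real ?n)) * H y)"
  proof
    fix y
    have "x - ((x - t *\<^sub>R x) + t *\<^sub>R y) = t *\<^sub>R (x - y)"
      by (simp add: algebra_simps)
    then have 1: "norm (x - ((x - t *\<^sub>R x) + t *\<^sub>R y)) = t * norm (x - y)"
      using t by simp
    have 2: "(x - t *\<^sub>R x) + t *\<^sub>R y = x + t *\<^sub>R (y - x)"
      by (simp add: algebra_simps)
    have 3: "indicator {..t * L} (t * norm (x - y)) = (indicator {..L} (norm (x - y)) :: ennreal)"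
      using t by (auto simp: indicator_def)
    have 4: "ennreal ((t * norm (x - y)) powr (a - real ?n))
        = ennreal (t powr (a - real ?n)) * ennreal (norm (x - y) powr (a - real ?n))"
      using t by (simp add: powr_mult ennreal_mult')
    show "indicator {..t * L} (norm (x - ((x - t *\<^sub>R x) + t *\<^sub>R y)))
        * ennreal (norm (x - ((x - t *\<^sub>R x) + t *\<^sub>R y)) powr (a - real ?n)) * G ((x - t *\<^sub>R x) + t *\<^sub>R y)
        = ennreal (t powr (a - real ?n)) * H y"
      unfolding 1 unfolding 2 3 4 H_def by (simp add: mult_ac)
  qed
  also have "(\<integral>\<^sup>+y. ennreal (t powr (a - real ?n)) * H y \<partial>lborel) = ennreal (t powr (a - real ?n)) * ?I"
    unfolding H_def[symmetric] by (rule nn_integral_cmult) simp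
  finally have "ennreal (t powr - a) * ?J
      = ennreal (t powr - a) * ennreal (\<bar>t\<bar> ^ ?n) * ennreal (t powr (a - real ?n)) * ?I"
    by (simp add: mult.assoc)
  also have "ennreal (t powr - a) * ennreal (\<bar>t\<bar> ^ ?n) * ennreal (t powr (a - real ?n))
      = ennreal (t powr - a * \<bar>t\<bar> ^ ?n * t powr (a - real ?n))"
    using t by (simp add: ennreal_mult')
  also have "t powr - a * \<bar>t\<bar> ^ ?n * t powr (a - real ?n) = 1"
    using t by (simp add: powr_realpow[symmetric] powr_add[symmetric])
  finally show ?thesis by simp
qed

text \<open>After the substitution, Tonelli lets \<open>x\<close> be integrated first. The inner
  integral is then the truncated potential of \<open>W\<close> at \<open>z\<close>, which the bound
  on balls controls by a multiple of \<open>K * W z\<close>.\<close>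

lemma nn_integral_segment_weight_le:
  fixes G W :: "'a::euclidean_space \<Rightarrow> ennreal"
  assumes [measurable]: "G \<in> borel_measurable borel" "W \<in> borel_measurable borel"
    and ball: "AE z in lborel. \<forall>r>0. (\<integral>\<^sup>+x\<in>cball z r. W x \<partial>lborel) \<le> ennreal (r ^ DIM('a)) * (K * W z)"
    and a: "a > 0" and L: "L > 0" and t: "t > 0"
  shows "(\<integral>\<^sup>+x. W x * (\<integral>\<^sup>+y. indicator {..L} (norm (x - y)) * ennreal (norm (x - y) powr (a - real DIM('a)))
            * G (x + t *\<^sub>R (y - x)) \<partial>lborel) \<partial>lborel)
    \<le> ennreal (2 ^ DIM('a) * L powr a / (1 - 2 powr - a)) * K * (\<integral>\<^sup>+z. G z * W z \<partial>lborel)"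
proof -
  let ?n = "DIM('a)"
  let ?k = "\<lambda>x z. indicator {..t * L} (norm (x - z)) * ennreal (norm (x - z) powr (a - real ?n))"
  let ?B = "ennreal (2 ^ ?n * (t * L) powr a / (1 - 2 powr - a))"
  have q: "2 powr - a < 1"
    using a powr_less_mono[of "- a" 0 2] by auto
  have "(\<integral>\<^sup>+x. W x * (\<integral>\<^sup>+y. indicator {..L} (norm (x - y)) * ennreal (norm (x - y) powr (a - real ?n))
            * G (x + t *\<^sub>R (y - x)) \<partial>lborel) \<partial>lborel)
      = (\<integral>\<^sup>+x. ennreal (t powr - a) * (\<integral>\<^sup>+z. W x * (?k x z * G z) \<partial>lborel) \<partial>lborel)"
    by (subst nn_integral_segment_kernel[OF _ t]) (simp_all add: nn_integral_cmult mult.left_commute)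
  also have "\<dots> = ennreal (t powr - a) * (\<integral>\<^sup>+x. (\<integral>\<^sup>+z. W x * (?k x z * G z) \<partial>lborel) \<partial>lborel)"
    by (rule nn_integral_cmult) measurable
  also have "(\<integral>\<^sup>+x. (\<integral>\<^sup>+z. W x * (?k x z * G z) \<partial>lborel) \<partial>lborel)
      = (\<integral>\<^sup>+z. (\<integral>\<^sup>+x. W x * (?k x z * G z) \<partial>lborel) \<partial>lborel)"
    by (rule lborel_pair.Fubini') measurable
  also have "\<dots> = (\<integral>\<^sup>+z. G z * (\<integral>\<^sup>+x. ?k x z * W x \<partial>lborel) \<partial>lborel)"
    by (subst nn_integral_cmult[symmetric]) (auto simp: mult_ac)
  also have "\<dots> \<le> (\<integral>\<^sup>+z. G z * (?B * (K * W z)) \<partial>lborel)"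
    using ball
  proof (intro nn_integral_mono_AE, eventually_elim)
    case (elim z)
    show ?case
      using elim a L t by (intro mult_left_mono nn_integral_riesz_kernel_le) auto
  qed
  also have "\<dots> = (\<integral>\<^sup>+z. (?B * K) * (G z * W z) \<partial>lborel)"
    by (simp add: mult_ac)
  also have "\<dots> = ?B * K * (\<integral>\<^sup>+z. G z * W z \<partial>lborel)"
    by (rule nn_integral_cmult) measurable
  finally have "(\<integral>\<^sup>+x. W x * (\<integral>\<^sup>+y. indicator {..L} (norm (x - y)) * ennreal (norm (x - y) powr (a - real ?n))
            * G (x + t *\<^sub>R (y - x)) \<partial>lborel) \<partial>lborel)
      \<le> ennreal (t powr - a) * (?B * K * (\<integral>\<^sup>+z. G z * W z \<partial>lborel))"
    by (simp add: mult_left_mono)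
  also have "\<dots> = (ennreal (t powr - a) * ?B) * K * (\<integral>\<^sup>+z. G z * W z \<partial>lborel)"
    by (simp add: mult.assoc)
  also have "ennreal (t powr - a) * ?B = ennreal (t powr - a * (2 ^ ?n * (t * L) powr a / (1 - 2 powr - a)))"
    by (rule ennreal_mult'[symmetric]) simp
  \<comment> \<open>The radius \<open>t * L\<close> contributes \<open>t powr a\<close>, which
    cancels the factor from the substitution and makes the bound uniform in
    \<open>t\<close>.\<close>
  also have "t powr - a * (2 ^ ?n * (t * L) powr a / (1 - 2 powr - a)) = 2 ^ ?n * L powr a / (1 - 2 powr - a)"
    using t L by (simp add: powr_mult powr_minus)
  finally show ?thesis .
qed

section \<open>The fractional energy for a Borel weight\<close>

text \<open>Continuity of the gradient is given on \<open>Q\<close> only; cutting it off to zero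
  outside the Borel set \<open>Q\<close> yields a Borel function that agrees with it on
  \<open>Q\<close>.\<close>

lemma C1_on_powr_grad_measurable:
  fixes u :: "real ^ 'n::finite \<Rightarrow> real"
  assumes "C1_on Q u" and [measurable]: "Q \<in> sets borel"
  shows "(\<lambda>z. indicator Q z * ennreal (norm (grad_within Q u z) powr p)) \<in> borel_measurable borel"
proof -
  have [measurable]: "(\<lambda>z. indicator Q z *\<^sub>R grad_within Q u z) \<in> borel_measurable borel"
    using assms by (intro borel_measurable_continuous_on_indicator) (auto simp: C1_on_def)
  have "(\<lambda>z. indicator Q z * ennreal (norm (grad_within Q u z) powr p))
      = (\<lambda>z. indicator Q z * ennreal (norm (indicator Q z *\<^sub>R grad_within Q u z) powr p))"
    by (auto simp: indicator_def)
  also have "\<dots> \<in> borel_measurable borel"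
    by measurable
  finally show ?thesis .
qed

lemma fractional_integrand_le:
  fixes u :: "real ^ 'n::finite \<Rightarrow> real"
  assumes C1: "C1_on Q u" and Q: "convex Q" "x \<in> Q" "y \<in> Q" and p: "p > 1"
  shows "ennreal (\<bar>u x - u y\<bar> powr p / norm (x - y) powr (real CARD('n) + \<delta> * p))
    \<le> ennreal (norm (x - y) powr ((1 - \<delta>) * p - real CARD('n))) *
       (\<integral>\<^sup>+t\<in>{0<..1}. (indicator Q (x + t *\<^sub>R (y - x)) * ennreal (norm (grad_within Q u (x + t *\<^sub>R (y - x))) powr p)) \<partial>lborel)"
\<comment> \<open>On the diagonal the left side is 0 because \<open>0 powr p = 0\<close>.\<close>
proof (cases "x = y")
  case False
  define s where "s = real CARD('n) + \<delta> * p"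
  let ?J = "\<integral>\<^sup>+t\<in>{0<..1}. ennreal (norm (grad_within Q u (x + t *\<^sub>R (y - x))) powr p) \<partial>lborel"
  have r: "norm (x - y) > 0"
    using False by simp
  have "ennreal (\<bar>u x - u y\<bar> powr p / norm (x - y) powr s)
      = ennreal (norm (x - y) powr - s) * ennreal (\<bar>u x - u y\<bar> powr p)"
    by (subst ennreal_mult'[symmetric]) (auto simp: powr_minus divide_inverse mult.commute)
  also have "\<dots> \<le> ennreal (norm (x - y) powr - s) * (ennreal (norm (x - y) powr p) * ?J)"
    by (intro mult_left_mono abs_diff_powr_le_nn_integral[OF C1 Q p]) simp
  also have "\<dots> = ennreal (norm (x - y) powr - s * norm (x - y) powr p) * ?J"
    by (subst ennreal_mult') (auto simp: mult.assoc)
  also have "norm (x - y) powr - s * norm (x - y) powr p = norm (x - y) powr ((1 - \<delta>) * p - real CARD('n))"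
    unfolding powr_add[symmetric] by (simp add: s_def algebra_simps)
  \<comment> \<open>By convexity the segment stays in \<open>Q\<close>, so the inserted indicator
    equals 1; it turns the gradient term into a Borel function on the whole space.\<close>
  also have "?J = (\<integral>\<^sup>+t\<in>{0<..1}. (indicator Q (x + t *\<^sub>R (y - x)) * ennreal (norm (grad_within Q u (x + t *\<^sub>R (y - x))) powr p)) \<partial>lborel)"
  proof (intro nn_integral_cong)
    fix t :: real
    have "x + t *\<^sub>R (y - x) \<in> Q" if "t \<in> {0<..1}"
      using convexD_alt[OF Q, of t] that by (simp add: algebra_simps)
    then show "ennreal (norm (grad_within Q u (x + t *\<^sub>R (y - x))) powr p) * indicator {0<..1} t
      = indicator Q (x + t *\<^sub>R (y - x)) * ennreal (norm (grad_within Q u (x + t *\<^sub>R (y - x))) powr p) * indicator {0<..1} t"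
      by (auto simp: indicator_def)
  qed
  finally show ?thesis
    by (simp add: s_def)
qed simp

text \<open>Tonelli brings \<open>t\<close> to the outside. For each \<open>t\<close> the bound of
  \<open>nn_integral_segment_weight_le\<close> is the same, and \<open>t\<close> ranges over a set
  of measure 1.\<close>

lemma fractional_energy_le:
  fixes u :: "real ^ 'n::finite \<Rightarrow> real" and W :: "real ^ 'n \<Rightarrow> ennreal"
  assumes C1: "C1_on Q u" and Q: "convex Q" and [measurable]: "Q \<in> sets borel" "W \<in> borel_measurable borel"
    and L: "L > 0" and diam: "\<And>x y. x \<in> Q \<Longrightarrow> y \<in> Q \<Longrightarrow> norm (x - y) \<le> L"
    and p: "p > 1" and \<delta>: "\<delta> < 1"
    and ball: "AE z in lborel. \<forall>r>0. (\<integral>\<^sup>+x\<in>cball z r. W x \<partial>lborel) \<le> ennreal (r ^ CARD('n)) * (K * W z)"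
  shows "(\<integral>\<^sup>+x\<in>Q. (\<integral>\<^sup>+y\<in>Q. ennreal (\<bar>u x - u y\<bar> powr p / norm (x - y) powr (real CARD('n) + \<delta> * p)) \<partial>lborel) * W x \<partial>lborel)
    \<le> ennreal (2 ^ CARD('n) * L powr ((1 - \<delta>) * p) / (1 - 2 powr - ((1 - \<delta>) * p))) * K *
       (\<integral>\<^sup>+x\<in>Q. ennreal (norm (grad_within Q u x) powr p) * W x \<partial>lborel)"
proof -
  let ?n = "CARD('n)"
  define a where "a = (1 - \<delta>) * p"
  have a: "a > 0" using p \<delta> by (simp add: a_def)
  have dim: "DIM(real ^ 'n) = ?n" by simp
  define G where "G z = indicator Q z * ennreal (norm (grad_within Q u z) powr p)" for z
  have [measurable]: "G \<in> borel_measurable borel"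
    unfolding G_def using C1 by (intro C1_on_powr_grad_measurable) auto
  define k where "k x y = indicator {..L} (norm (x - y)) * ennreal (norm (x - y) powr (a - real ?n))" for x y :: "real ^ 'n"
  have [measurable]: "case_prod k \<in> borel_measurable (borel \<Otimes>\<^sub>M borel)"
    unfolding k_def by measurable
  let ?B = "ennreal (2 ^ ?n * L powr a / (1 - 2 powr - a)) * K * (\<integral>\<^sup>+z. G z * W z \<partial>lborel)"
  have "(\<integral>\<^sup>+x\<in>Q. (\<integral>\<^sup>+y\<in>Q. ennreal (\<bar>u x - u y\<bar> powr p / norm (x - y) powr (real ?n + \<delta> * p)) \<partial>lborel) * W x \<partial>lborel)
      \<le> (\<integral>\<^sup>+x. W x * (\<integral>\<^sup>+y. k x y * (\<integral>\<^sup>+t\<in>{0<..1}. G (x + t *\<^sub>R (y - x)) \<partial>lborel) \<partial>lborel) \<partial>lborel)"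
  proof (intro nn_integral_mono)
    fix x
    have "(\<integral>\<^sup>+y\<in>Q. ennreal (\<bar>u x - u y\<bar> powr p / norm (x - y) powr (real ?n + \<delta> * p)) \<partial>lborel)
        \<le> (\<integral>\<^sup>+y. k x y * (\<integral>\<^sup>+t\<in>{0<..1}. G (x + t *\<^sub>R (y - x)) \<partial>lborel) \<partial>lborel)" if x: "x \<in> Q"
    proof (intro nn_integral_mono)
      fix y
      show "ennreal (\<bar>u x - u y\<bar> powr p / norm (x - y) powr (real ?n + \<delta> * p)) * indicator Q y
          \<le> k x y * (\<integral>\<^sup>+t\<in>{0<..1}. G (x + t *\<^sub>R (y - x)) \<partial>lborel)"
      proof (cases "y \<in> Q")
        case True
        \<comment> \<open>The truncation at \<open>L\<close> is invisible for two points of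
          \<open>Q\<close>, whose distance is at most \<open>L\<close>.\<close>
        have "k x y = ennreal (norm (x - y) powr ((1 - \<delta>) * p - real ?n))"
          using diam[OF x True] by (simp add: k_def a_def)
        then show ?thesis
          using fractional_integrand_le[OF C1 Q x True p, of \<delta>] True by (simp add: G_def)
      qed simp
    qed
    then show "(\<integral>\<^sup>+y\<in>Q. ennreal (\<bar>u x - u y\<bar> powr p / norm (x - y) powr (real ?n + \<delta> * p)) \<partial>lborel) * W x * indicator Q x
        \<le> W x * (\<integral>\<^sup>+y. k x y * (\<integral>\<^sup>+t\<in>{0<..1}. G (x + t *\<^sub>R (y - x)) \<partial>lborel) \<partial>lborel)"
      by (cases "x \<in> Q") (auto simp: mult.commute intro: mult_left_mono)
  qed
  \<comment> \<open>First exchange, for fixed \<open>x\<close>: the order of \<open>y\<close> and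
    \<open>t\<close>. The exchange of \<open>x\<close> and \<open>t\<close> follows.\<close>
  also have "\<dots> = (\<integral>\<^sup>+x. W x * (\<integral>\<^sup>+t\<in>{0<..1}. (\<integral>\<^sup>+y. k x y * G (x + t *\<^sub>R (y - x)) \<partial>lborel) \<partial>lborel) \<partial>lborel)"
  proof (intro nn_integral_cong arg_cong2[where f="(*)"] refl)
    fix x
    have [measurable]: "k x \<in> borel_measurable borel"
      unfolding k_def by measurable
    have "(\<integral>\<^sup>+y. k x y * (\<integral>\<^sup>+t\<in>{0<..1}. G (x + t *\<^sub>R (y - x)) \<partial>lborel) \<partial>lborel)
        = (\<integral>\<^sup>+y. (\<integral>\<^sup>+t. k x y * (G (x + t *\<^sub>R (y - x)) * indicator {0<..1} t) \<partial>lborel) \<partial>lborel)"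
      by (intro nn_integral_cong nn_integral_cmult[symmetric]) measurable
    also have "\<dots> = (\<integral>\<^sup>+t. (\<integral>\<^sup>+y. k x y * (G (x + t *\<^sub>R (y - x)) * indicator {0<..1} t) \<partial>lborel) \<partial>lborel)"
      by (rule lborel_pair.Fubini') measurable
    also have "\<dots> = (\<integral>\<^sup>+t\<in>{0<..1}. (\<integral>\<^sup>+y. k x y * G (x + t *\<^sub>R (y - x)) \<partial>lborel) \<partial>lborel)"
      by (intro nn_integral_cong) (simp add: nn_integral_multc mult.assoc[symmetric])
    finally show "(\<integral>\<^sup>+y. k x y * (\<integral>\<^sup>+t\<in>{0<..1}. G (x + t *\<^sub>R (y - x)) \<partial>lborel) \<partial>lborel) = \<dots>" .
  qed
  also have "\<dots> = (\<integral>\<^sup>+x. (\<integral>\<^sup>+t. W x * ((\<integral>\<^sup>+y. k x y * G (x + t *\<^sub>R (y - x)) \<partial>lborel) * indicator {0<..1} t) \<partial>lborel) \<partial>lborel)"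
    by (intro nn_integral_cong nn_integral_cmult[symmetric]) measurable
  also have "\<dots> = (\<integral>\<^sup>+t. (\<integral>\<^sup>+x. W x * ((\<integral>\<^sup>+y. k x y * G (x + t *\<^sub>R (y - x)) \<partial>lborel) * indicator {0<..1} t) \<partial>lborel) \<partial>lborel)"
    by (rule lborel_pair.Fubini') measurable
  also have "\<dots> \<le> (\<integral>\<^sup>+t. ?B * indicator {0<..1::real} t \<partial>lborel)"
  proof (intro nn_integral_mono)
    fix t :: real
    have "(\<integral>\<^sup>+x. W x * (\<integral>\<^sup>+y. k x y * G (x + t *\<^sub>R (y - x)) \<partial>lborel) \<partial>lborel) \<le> ?B" if "t > 0"
      unfolding k_def using nn_integral_segment_weight_le[of G W K a L t] ball a L that
      unfolding dim by simp
    then show "(\<integral>\<^sup>+x. W x * ((\<integral>\<^sup>+y. k x y * G (x + t *\<^sub>R (y - x)) \<partial>lborel) * indicator {0<..1} t) \<partial>lborel)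
        \<le> ?B * indicator {0<..1} t"
      by (cases "t \<in> {0<..1}") auto
  qed
  also have "\<dots> = ?B"
    by (subst nn_integral_cmult_indicator) auto
  also have "(\<integral>\<^sup>+z. G z * W z \<partial>lborel) = (\<integral>\<^sup>+x\<in>Q. ennreal (norm (grad_within Q u x) powr p) * W x \<partial>lborel)"
    by (intro nn_integral_cong) (simp add: G_def mult_ac)
  finally show ?thesis
    by (simp add: a_def)
qed

section \<open>Elementary bounds for constants and powers\<close>

text \<open>This bounds the sum of the geometric series by a multiple of \<open>1 / min 1 a\<close>.
  With \<open>b = min 1 a\<close>, convexity of the exponential gives
  \<open>2 powr b \<ge> 1 + b * ln 2 \<ge> 1 + b / 2\<close>, and \<open>b \<le> 1\<close> brings
  the reciprocal below \<open>1 - b / 4\<close>.\<close>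

lemma one_minus_two_powr_ge:
  fixes a :: real
  assumes "a > 0"
  shows "min 1 a / 4 \<le> 1 - 2 powr - a"
proof -
  define b where "b = min 1 a"
  have b: "0 < b" "b \<le> 1" "b \<le> a"
    using assms by (auto simp: b_def)
  have "1 + b / 2 \<le> 1 + b * ln 2"
    using b ln2_ge_two_thirds by simp
  also have "\<dots> \<le> 2 powr b"
    using exp_ge_add_one_self[of "b * ln 2"] by (simp add: powr_def)
  also have "\<dots> \<le> 2 powr a"
    using b by simp
  finally have "1 + b / 2 \<le> 2 powr a" .
  then have "2 powr - a \<le> 1 / (1 + b / 2)"
    using b by (simp add: powr_minus field_simps)
  also have "\<dots> \<le> 1 - b / 4"
  proof -
    have "b * b \<le> b * 1"
      using b by (intro mult_left_mono) auto
    then show ?thesis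
      using b by (simp add: field_simps)
  qed
  finally show ?thesis
    unfolding b_def[symmetric] using b by simp
qed

lemma ennreal_powr_le_mult:
  assumes "x \<le> ennreal M * y" "M > 0" "q > 0"
  shows "ennreal_powr x q \<le> ennreal (M powr q) * ennreal_powr y q"
proof (cases "y = \<infinity>")
  case True
  \<comment> \<open>The right side is infinite because \<open>M powr q\<close> is positive; with a
    zero factor the product would be 0.\<close>
  then show ?thesis
    using assms by (simp add: ennreal_powr_def ennreal_mult_top)
next
  case False
  then obtain b where b: "y = ennreal b" "b \<ge> 0"
    by (cases y) auto
  have le: "x \<le> ennreal (M * b)"
    using assms b by (simp add: ennreal_mult')
  then obtain c where c: "x = ennreal c" "c \<ge> 0"
    by (cases x) (auto simp: top_unique)
  have "c \<le> M * b"
    using le c b assms by (simp add: ennreal_le_iff)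
  then have "c powr q \<le> (M * b) powr q"
    using c assms by (intro powr_mono2) auto
  also have "\<dots> = M powr q * b powr q"
    by (rule powr_mult)
  finally show ?thesis
    using b c by (simp add: ennreal_powr_def ennreal_mult'[symmetric] ennreal_leI)
qed

section \<open>The estimate for \<open>A_1\<close> weights and its constant\<close>

text \<open>The Tonelli arguments run over \<open>lborel\<close>, while \<open>w\<close> is only
  Lebesgue measurable. So \<open>w\<close> is replaced by an almost everywhere equal Borel function
  \<open>W\<close>, and \<open>fractional_energy_le\<close> is applied with
  \<open>K = 4 ^ n * A1_const w\<close> and \<open>L = n * l\<close>.\<close>

lemma weighted_fractional_energy_le:
  fixes w u :: "real ^ 'n::finite \<Rightarrow> real"
  assumes w: "in_A1 w" and Q: "cube Q l" and C1: "C1_on Q u" and p: "p > 1" and \<delta>: "\<delta> < 1"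
  shows "(\<integral>\<^sup>+x\<in>Q. (\<integral>\<^sup>+y\<in>Q. ennreal (\<bar>u x - u y\<bar> powr p / norm (x - y) powr (real CARD('n) + \<delta> * p)) \<partial>lebesgue)
            * ennreal (w x) \<partial>lebesgue)
    \<le> ennreal (8 ^ CARD('n) * A1_const w * (real CARD('n) * l) powr ((1 - \<delta>) * p) / (1 - 2 powr - ((1 - \<delta>) * p))) *
       (\<integral>\<^sup>+x\<in>Q. ennreal (norm (grad_within Q u x) powr p) * ennreal (w x) \<partial>lebesgue)"
proof -
  let ?n = "CARD('n)"
  define a where "a = (1 - \<delta>) * p"
  have "a > 0" using p \<delta> by (simp add: a_def)
  then have q: "1 - 2 powr - a > 0"
    using one_minus_two_powr_ge[of a] by simp
  have A: "A1_const w \<ge> 1" by (rule A1_const_ge_1[OF w])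
  have pos: "AE z in lborel. w z > 0" and wt: "weight w"
    using w by (auto simp: in_A1_def weight_def AE_completion_iff)
  have "(\<lambda>x. ennreal (w x)) \<in> borel_measurable lebesgue"
    using weight_measurable[OF wt] by simp
  then obtain W where W: "W \<in> borel_measurable borel" and ae: "AE x in lborel. ennreal (w x) = W x"
    using completion_ex_borel_measurable[of "\<lambda>x. ennreal (w x)" lborel] by auto
  have "AE z in lborel. \<forall>r>0. (\<integral>\<^sup>+x\<in>cball z r. ennreal (w x) \<partial>lborel) \<le> ennreal ((4 * r) ^ ?n * A1_const w * w z)"
    using A1_ball_le[OF w] by (simp add: AE_completion_iff nn_integral_completion)
  then have ball: "AE z in lborel. \<forall>r>0. (\<integral>\<^sup>+x\<in>cball z r. W x \<partial>lborel) \<le> ennreal (r ^ ?n) * (ennreal (4 ^ ?n * A1_const w) * W z)"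
    using ae
  proof eventually_elim
    case (elim z)
    show ?case
    proof (intro allI impI)
      fix r :: real assume r: "r > 0"
      have "(\<integral>\<^sup>+x\<in>cball z r. W x \<partial>lborel) = (\<integral>\<^sup>+x\<in>cball z r. ennreal (w x) \<partial>lborel)"
        using ae by (intro nn_integral_cong_AE) (auto elim!: eventually_mono)
      also have "\<dots> \<le> ennreal (r ^ ?n * (4 ^ ?n * A1_const w * w z))"
        using elim(1) r by (simp add: power_mult_distrib mult_ac)
      also have "\<dots> = ennreal (r ^ ?n) * (ennreal (4 ^ ?n * A1_const w) * W z)"
        using r A elim(2)[symmetric] by (simp add: ennreal_mult')
      finally show "(\<integral>\<^sup>+x\<in>cball z r. W x \<partial>lborel) \<le> \<dots>" .
    qed
  qed
  have "(\<integral>\<^sup>+x\<in>Q. (\<integral>\<^sup>+y\<in>Q. ennreal (\<bar>u x - u y\<bar> powr p / norm (x - y) powr (real ?n + \<delta> * p)) \<partial>lebesgue)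
            * ennreal (w x) \<partial>lebesgue)
      = (\<integral>\<^sup>+x\<in>Q. (\<integral>\<^sup>+y\<in>Q. ennreal (\<bar>u x - u y\<bar> powr p / norm (x - y) powr (real ?n + \<delta> * p)) \<partial>lborel) * W x \<partial>lborel)"
    unfolding nn_integral_completion using ae by (intro nn_integral_cong_AE) (auto elim!: eventually_mono)
  also have "\<dots> \<le> ennreal (2 ^ ?n * (real ?n * l) powr a / (1 - 2 powr - a)) * ennreal (4 ^ ?n * A1_const w) *
       (\<integral>\<^sup>+x\<in>Q. ennreal (norm (grad_within Q u x) powr p) * W x \<partial>lborel)"
    unfolding a_def
    by (intro fractional_energy_le C1 convex_cube[OF Q] borel_cube[OF Q] W cube_norm_le[OF Q] p \<delta> ball)
       (use cube_pos[OF Q] in auto)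
  also have "(\<integral>\<^sup>+x\<in>Q. ennreal (norm (grad_within Q u x) powr p) * W x \<partial>lborel)
      = (\<integral>\<^sup>+x\<in>Q. ennreal (norm (grad_within Q u x) powr p) * ennreal (w x) \<partial>lebesgue)"
    unfolding nn_integral_completion using ae by (intro nn_integral_cong_AE) (auto elim!: eventually_mono)
  also have "ennreal (2 ^ ?n * (real ?n * l) powr a / (1 - 2 powr - a)) * ennreal (4 ^ ?n * A1_const w)
      = ennreal (2 ^ ?n * (real ?n * l) powr a / (1 - 2 powr - a) * (4 ^ ?n * A1_const w))"
    using q by (intro ennreal_mult'[symmetric]) simp
  \<comment> \<open>The factor \<open>8 ^ n\<close> collects \<open>2 ^ n\<close> from the dyadic
    shells and \<open>4 ^ n\<close> from the cubes enclosing balls.\<close>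
  also have "2 ^ ?n * (real ?n * l) powr a / (1 - 2 powr - a) * (4 ^ ?n * A1_const w)
      = 8 ^ ?n * A1_const w * (real ?n * l) powr a / (1 - 2 powr - a)"
    using power_mult_distrib[of "2::real" 4 ?n] by simp
  finally show ?thesis
    by (simp add: a_def)
qed

text \<open>The root of order \<open>p\<close> turns \<open>(n * l) powr a\<close> into
  \<open>(n * l) powr (1 - \<delta>)\<close>, and \<open>l powr \<delta>\<close> completes the power
  of \<open>l\<close> to exactly 1.\<close>

lemma fractional_constant_le:
  fixes n A B l \<delta> p :: real
  assumes "n \<ge> 1" "A \<ge> 1" "B \<ge> 1" "l > 0" "0 < \<delta>" "\<delta> < 1" "1 < p"
  defines "a \<equiv> (1 - \<delta>) * p"
  shows "l powr \<delta> * (B * A * (n * l) powr a / (1 - 2 powr - a)) powr (1 / p)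
    \<le> 4 * B * n * (p / (p - 1)) / (1 - \<delta>) powr (1 / p) * A powr (2 / p) * l"
proof -
  \<comment> \<open>From \<open>p > 1\<close> follows \<open>a \<ge> 1 - \<delta>\<close>, so the
    denominator is bounded below in terms of \<open>\<delta>\<close> alone, uniformly in
    \<open>p\<close>.\<close>
  have "1 * (1 - \<delta>) \<le> p * (1 - \<delta>)"
    using assms by (intro mult_right_mono) auto
  then have a: "a \<ge> 1 - \<delta>" "a > 0"
    using assms by (auto simp: a_def mult.commute)
  have q: "(1 - \<delta>) / 4 \<le> 1 - 2 powr - a"
  proof -
    have "1 - \<delta> \<le> min 1 a"
      using a(1) \<open>0 < \<delta>\<close> by simp
    then have "(1 - \<delta>) / 4 \<le> min 1 a / 4"
      by (rule divide_right_mono) simp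
    also note one_minus_two_powr_ge[OF a(2)]
    finally show ?thesis .
  qed
  have "B * A * (n * l) powr a / (1 - 2 powr - a) \<le> B * A * (n * l) powr a / ((1 - \<delta>) / 4)"
    using q assms by (intro divide_left_mono) auto
  also have "\<dots> = (4 * B) * A * (n * l) powr a / (1 - \<delta>)"
    by simp
  finally have "(B * A * (n * l) powr a / (1 - 2 powr - a)) powr (1 / p)
      \<le> ((4 * B) * A * (n * l) powr a / (1 - \<delta>)) powr (1 / p)"
    using q assms by (intro powr_mono2) auto
  also have "\<dots> = (4 * B) powr (1 / p) * A powr (1 / p) * ((n * l) powr a) powr (1 / p) / (1 - \<delta>) powr (1 / p)"
    using assms by (simp add: powr_mult powr_divide)
  also have "((n * l) powr a) powr (1 / p) = n powr (1 - \<delta>) * l powr (1 - \<delta>)"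
    using assms by (simp add: powr_powr a_def powr_mult)
  \<comment> \<open>The bases \<open>4 * B\<close>, \<open>A\<close> and \<open>n\<close> are at
    least 1, so raising their exponents to 1, \<open>2 / p\<close> and 1 only increases the
    product.\<close>
  also have "(4 * B) powr (1 / p) * A powr (1 / p) * (n powr (1 - \<delta>) * l powr (1 - \<delta>)) / (1 - \<delta>) powr (1 / p)
      \<le> (4 * B) * A powr (2 / p) * (n * l powr (1 - \<delta>)) / (1 - \<delta>) powr (1 / p)"
  proof (intro divide_right_mono mult_mono)
    show "(4 * B) powr (1 / p) \<le> 4 * B"
      using powr_mono[of "1 / p" 1 "4 * B"] assms by simp
    show "A powr (1 / p) \<le> A powr (2 / p)"
      using assms by (intro powr_mono divide_right_mono) auto
    show "n powr (1 - \<delta>) \<le> n"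
      using powr_mono[of "1 - \<delta>" 1 n] assms by simp
  qed (use assms in auto)
  finally have "l powr \<delta> * (B * A * (n * l) powr a / (1 - 2 powr - a)) powr (1 / p)
      \<le> l powr \<delta> * ((4 * B) * A powr (2 / p) * (n * l powr (1 - \<delta>)) / (1 - \<delta>) powr (1 / p))"
    using assms by (intro mult_left_mono) auto
  also have "\<dots> = (4 * B * n * A powr (2 / p) / (1 - \<delta>) powr (1 / p)) * (l powr \<delta> * l powr (1 - \<delta>))"
    by simp
  also have "l powr \<delta> * l powr (1 - \<delta>) = l"
    using assms by (simp flip: powr_add)
  \<comment> \<open>The conjugate exponent \<open>p / (p - 1)\<close> is at least 1 and enters here
    as a factor.\<close>
  also have "(4 * B * n * A powr (2 / p) / (1 - \<delta>) powr (1 / p)) * l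
      \<le> (4 * B * n * A powr (2 / p) / (1 - \<delta>) powr (1 / p) * l) * (p / (p - 1))"
  proof -
    have "1 \<le> p / (p - 1)"
      using assms by simp
    moreover have "0 \<le> 4 * B * n * A powr (2 / p) / (1 - \<delta>) powr (1 / p) * l"
      using assms by (intro mult_nonneg_nonneg divide_nonneg_nonneg) auto
    ultimately show ?thesis
      using mult_left_mono by fastforce
  qed
  finally show ?thesis
    by (simp add: mult_ac)
qed

theorem theorem2p1:
  assumes "CARD('n::finite) \<ge> 2"
  shows "\<exists>C>0. \<forall>(\<delta>::real) (p::real) (w :: real ^ 'n \<Rightarrow> real) (Q :: (real ^ 'n) set) (l::real) (u :: real ^ 'n \<Rightarrow> real).
           0 < \<delta> \<longrightarrow> \<delta> < 1 \<longrightarrow> 1 < p \<longrightarrow> in_A1 w \<longrightarrow> cube Q l \<longrightarrow> C1_on Q u \<longrightarrow>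
           ennreal (l powr \<delta>) *
             ennreal_powr
               (\<integral>\<^sup>+x\<in>Q. (\<integral>\<^sup>+y\<in>Q. ennreal (\<bar>u x - u y\<bar> powr p / norm (x - y) powr (real CARD('n) + \<delta> * p)) \<partial>lebesgue)
                  * ennreal (w x) \<partial>lebesgue)
               (1 / p)
           \<le> ennreal (C * (p / (p - 1)) / (1 - \<delta>) powr (1 / p) * A1_const w powr (2 / p) * l) *
             ennreal_powr
               (\<integral>\<^sup>+x\<in>Q. ennreal (norm (grad_within Q u x) powr p) * ennreal (w x) \<partial>lebesgue)
               (1 / p)"
\<comment> \<open>In the witness, \<open>8 ^ n\<close> is the constant of the energy estimate,
  \<open>4\<close> comes from \<open>1 - 2 powr - a \<ge> (1 - \<delta>) / 4\<close>, and
  \<open>n\<close> from the diameter bound \<open>n * l\<close>.\<close>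
proof (intro exI[of _ "4 * 8 ^ CARD('n) * real CARD('n)"] conjI allI impI)
  let ?n = "CARD('n)"
  show "4 * 8 ^ ?n * real ?n > 0"
    by simp
  fix \<delta> p l :: real and w u :: "real ^ 'n \<Rightarrow> real" and Q :: "(real ^ 'n) set"
  assume \<delta>: "0 < \<delta>" "\<delta> < 1" and p: "1 < p" and w: "in_A1 w" and Q: "cube Q l" and C1: "C1_on Q u"
  define E where "E = (\<integral>\<^sup>+x\<in>Q. (\<integral>\<^sup>+y\<in>Q. ennreal (\<bar>u x - u y\<bar> powr p / norm (x - y) powr (real ?n + \<delta> * p)) \<partial>lebesgue)
                  * ennreal (w x) \<partial>lebesgue)"
  define D where "D = (\<integral>\<^sup>+x\<in>Q. ennreal (norm (grad_within Q u x) powr p) * ennreal (w x) \<partial>lebesgue)"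
  define M where "M = 8 ^ ?n * A1_const w * (real ?n * l) powr ((1 - \<delta>) * p) / (1 - 2 powr - ((1 - \<delta>) * p))"
  have A: "A1_const w \<ge> 1" and l: "l > 0"
    using A1_const_ge_1[OF w] cube_pos[OF Q] by auto
  have "(1 - \<delta>) * p > 0"
    using \<delta> p by simp
  then have "1 - 2 powr - ((1 - \<delta>) * p) > 0"
    using one_minus_two_powr_ge[of "(1 - \<delta>) * p"] by linarith
  \<comment> \<open>Positivity of \<open>M\<close> lets the root be taken also when \<open>D\<close>
    is infinite.\<close>
  then have "M > 0"
    using A l unfolding M_def by (intro divide_pos_pos mult_pos_pos) auto
  moreover have "E \<le> ennreal M * D"
    unfolding E_def D_def M_def by (rule weighted_fractional_energy_le[OF w Q C1 p \<delta>(2)])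
  ultimately have "ennreal (l powr \<delta>) * ennreal_powr E (1 / p)
      \<le> ennreal (l powr \<delta>) * (ennreal (M powr (1 / p)) * ennreal_powr D (1 / p))"
    using p by (intro mult_left_mono ennreal_powr_le_mult) auto
  also have "\<dots> = ennreal (l powr \<delta> * M powr (1 / p)) * ennreal_powr D (1 / p)"
    by (simp add: ennreal_mult' mult.assoc)
  also have "\<dots> \<le> ennreal (4 * 8 ^ ?n * real ?n * (p / (p - 1)) / (1 - \<delta>) powr (1 / p) * A1_const w powr (2 / p) * l)
      * ennreal_powr D (1 / p)"
    unfolding M_def using A l \<delta> p
    by (intro mult_right_mono ennreal_leI fractional_constant_le) (auto simp: Suc_leI)
  finally show "ennreal (l powr \<delta>) * ennreal_powr E (1 / p)
      \<le> ennreal (4 * 8 ^ ?n * real ?n * (p / (p - 1)) / (1 - \<delta>) powr (1 / p) * A1_const w powr (2 / p) * l)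
      * ennreal_powr D (1 / p)" .
qed

end
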